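(* Let $K\ge 1$, $\mathcal{K}=\{1,\dots,K\}$, let $B,L,N_0,\lambda>0$, and for each $k\in\mathcal{K}$ let $h_k>0$, $T_k>0$, $\gamma_k\in(0,1]$ and $t_k=T_k$ be given. Consider the optimization problem $$ \begin{aligned} \min_{\{\beta_k\}_{k\in\mathcal K}}\quad &\sum_{k=1}^K\frac{\gamma_kBt_kN_0}{h_k^2}\left(2^{\frac{\beta_kL}{\gamma_kBt_k}}-1\right)-\lambda\sum_{k=1}^K\beta_k\\ \text{s.t.}\quad &0\le\beta_k\le 1,\ k\in\mathcal{K}. \end{aligned} $$ The optimal solution is $$ \beta_k^{\star}=\min\left\{\max\left\{\frac{\gamma_kBT_k}{L}\log_2\left(\frac{\lambda h_k^2}{N_0L\ln 2}\right),\,0\right\},\,1\right\},\qquad k\in\mathcal{K}. $$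
   Context: Interpretation: $K$ edge devices upload a model of $L$ bits over total bandwidth $B$; $\gamma_k$ is the bandwidth fraction of device $k$, $h_k$ its channel gain, $N_0$ the noise variance, $t_k$ its uploading time and $T_k$ its maximal allowed uploading time; $\lambda$ is a fixed trade-off factor between energy and learning speed $\sum_k\beta_k$; and $\beta_k\in[0,1]$ is the (relaxed) selection priority of device $k$. *)

theory Defs
  imports "HOL-Analysis.Analysis"
begin

text \<open>
  A priority vector is a function on \<^typ>\<open>nat\<close>; only its values on the device set
  \<^term>\<open>{1..K}\<close> are meaningful, and everything below depends on those values only.
\<close>

definition selection_objective ::
  "nat \<Rightarrow> real \<Rightarrow> real \<Rightarrow> real \<Rightarrow> real \<Rightarrow> (nat \<Rightarrow> real) \<Rightarrow> (nat \<Rightarrow> real) \<Rightarrow> (nat \<Rightarrow> real)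
    \<Rightarrow> (nat \<Rightarrow> real) \<Rightarrow> real"
where
  "selection_objective K B L N0 lam h \<gamma> t \<beta> =
     (\<Sum>k=1..K. \<gamma> k * B * t k * N0 / (h k)\<^sup>2 * (2 powr (\<beta> k * L / (\<gamma> k * B * t k)) - 1))
     - lam * (\<Sum>k=1..K. \<beta> k)"

definition selection_feasible :: "nat \<Rightarrow> (nat \<Rightarrow> real) \<Rightarrow> bool" where
  "selection_feasible K \<beta> \<longleftrightarrow> (\<forall>k\<in>{1..K}. 0 \<le> \<beta> k \<and> \<beta> k \<le> 1)"

end

theory Submission
  imports Defs
begin

text \<open>
  The problem separates over the devices. In one coordinate, the objective is a constant plus
  \<open>c * exp (a * x) - lam * x\<close>, which is strictly convex with critical point
  \<open>x0 = ln (lam / (c * a)) / a\<close>; its strict minimiser over the unit interval is the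
  projection of \<open>x0\<close> onto that interval.
\<close>

text \<open>Each summand sees one coordinate, and so does each constraint, so coordinatewise strict
  minimisers combine into a minimiser of the sum. Values outside \<open>A\<close> are free, hence
  agreement on \<open>A\<close> instead of equality of functions.\<close>

lemma is_arg_min_sum_iff:
  fixes g :: "'a \<Rightarrow> 'b \<Rightarrow> 'c::{ordered_cancel_comm_monoid_add, linorder}"
  assumes fin: "finite A"
    and p: "\<And>k. k \<in> A \<Longrightarrow> p k \<in> S k"
    and less: "\<And>k x. k \<in> A \<Longrightarrow> x \<in> S k \<Longrightarrow> x \<noteq> p k \<Longrightarrow> g k (p k) < g k x"
  shows "is_arg_min (\<lambda>x. \<Sum>k\<in>A. g k (x k)) (\<lambda>x. \<forall>k\<in>A. x k \<in> S k) y \<longleftrightarrow> (\<forall>k\<in>A. y k = p k)"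
proof
  assume y: "is_arg_min (\<lambda>x. \<Sum>k\<in>A. g k (x k)) (\<lambda>x. \<forall>k\<in>A. x k \<in> S k) y"
  then have yS: "y k \<in> S k" if "k \<in> A" for k
    using that by (simp add: is_arg_min_def)
  have le: "g k (p k) \<le> g k (y k)" if "k \<in> A" for k
    using less[OF that yS[OF that]] by (cases "y k = p k") auto
  show "\<forall>k\<in>A. y k = p k"
  proof (rule ccontr)
    assume "\<not> (\<forall>k\<in>A. y k = p k)"
    \<comment> \<open>One strict coordinate makes \<open>p\<close>, itself feasible, strictly better
      than \<open>y\<close>.\<close>
    then have "\<exists>k\<in>A. g k (p k) < g k (y k)"
      using less yS by blast
    then have "(\<Sum>k\<in>A. g k (p k)) < (\<Sum>k\<in>A. g k (y k))"
      using fin le by (intro sum_strict_mono_ex1) auto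
    then show False
      using y p unfolding is_arg_min_def by blast
  qed
next
  assume y: "\<forall>k\<in>A. y k = p k"
  have "(\<Sum>k\<in>A. g k (y k)) \<le> (\<Sum>k\<in>A. g k (z k))" if z: "\<forall>k\<in>A. z k \<in> S k" for z
  proof (rule sum_mono)
    fix k assume "k \<in> A"
    then show "g k (y k) \<le> g k (z k)"
      using y z less[of k "z k"] by (cases "z k = p k") auto
  qed
  moreover have "\<forall>k\<in>A. y k \<in> S k"
    using y p by simp
  ultimately show "is_arg_min (\<lambda>x. \<Sum>k\<in>A. g k (x k)) (\<lambda>x. \<forall>k\<in>A. x k \<in> S k) y"
    unfolding is_arg_min_def not_less[symmetric] by blast
qed

text \<open>Equality would give \<open>ln y = y - 1\<close> at \<open>y = exp x\<close>, which
  forces \<open>y = 1\<close>.\<close>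

lemma exp_gt_add_one: "1 + x < exp x" if "x \<noteq> 0" for x :: real
proof -
  have "exp x \<noteq> 1 + x"
    using ln_eq_minus_one[of "exp x"] that by auto
  then show ?thesis
    using exp_ge_add_one_self[of x] by linarith
qed

lemma exp_sub_linear_strict_min_interval:
  fixes a c lam l u x x0 :: real
  assumes "a > 0" "c > 0" "lam > 0"
    and x: "x \<in> {l..u}" "x \<noteq> min (max x0 l) u"
    and x0: "x0 = ln (lam / (c * a)) / a"
  shows "c * exp (a * min (max x0 l) u) - lam * min (max x0 l) u < c * exp (a * x) - lam * x"
proof -
  define p where "p = min (max x0 l) u"
  have ne: "x - p \<noteq> 0"
    using x by (simp add: p_def)
  have crit: "c * a * exp (a * x0) = lam"
    using assms by simp
  \<comment> \<open>First-order optimality at \<open>p\<close>: by \<open>crit\<close> the left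
    factor is the derivative there. If \<open>p > x0\<close>, then \<open>p = l\<close>; if
    \<open>p < x0\<close>, then \<open>p = u\<close>; so \<open>x - p\<close> has the sign of that
    factor or vanishes.\<close>
  have slope: "0 \<le> (c * a * exp (a * p) - c * a * exp (a * x0)) * (x - p)"
  proof -
    consider "p = x0" | "p > x0" "x \<ge> p" | "p < x0" "x \<le> p"
      using x(1) unfolding p_def
      by (cases "p = x0"; cases "p < x0"; simp add: p_def min_def max_def split: if_splits)
    then show ?thesis
      using \<open>a > 0\<close> \<open>c > 0\<close>
      by cases (auto intro: mult_nonneg_nonneg mult_nonpos_nonpos)
  qed
  \<comment> \<open>The graph lies strictly above its tangent at \<open>p\<close>;
    \<open>slope\<close> then bounds the tangent's increment below by
    \<open>lam * (x - p)\<close>.\<close>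
  have "c * exp (a * p) * (1 + a * (x - p)) < c * exp (a * p) * exp (a * (x - p))"
    using assms ne by (intro mult_strict_left_mono exp_gt_add_one) auto
  also have "\<dots> = c * exp (a * x)"
    by (simp add: algebra_simps flip: exp_add)
  finally show ?thesis
    using slope unfolding crit p_def[symmetric] by (simp add: algebra_simps)
qed

theorem theorem2:
  fixes K :: nat and B L N0 lam :: real and h T \<gamma> t \<beta> :: "nat \<Rightarrow> real"
  assumes "K \<ge> 1"
    and "B > 0" and "L > 0" and "N0 > 0" and "lam > 0"
    and "\<And>k. k \<in> {1..K} \<Longrightarrow> h k > 0"
    and "\<And>k. k \<in> {1..K} \<Longrightarrow> T k > 0"
    and "\<And>k. k \<in> {1..K} \<Longrightarrow> 0 < \<gamma> k \<and> \<gamma> k \<le> 1"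
    and "\<And>k. k \<in> {1..K} \<Longrightarrow> t k = T k"
  shows "is_arg_min (selection_objective K B L N0 lam h \<gamma> t) (selection_feasible K) \<beta>
    \<longleftrightarrow> (\<forall>k\<in>{1..K}. \<beta> k =
          min (max (\<gamma> k * B * T k / L * log 2 (lam * (h k)\<^sup>2 / (N0 * L * ln 2))) 0) 1)"
proof -
  define g where "g k x = \<gamma> k * B * t k * N0 / (h k)\<^sup>2 * (2 powr (x * L / (\<gamma> k * B * t k)) - 1)
    - lam * x" for k x
  define p where "p k = min (max (\<gamma> k * B * T k / L * log 2 (lam * (h k)\<^sup>2 / (N0 * L * ln 2))) 0) 1"
    for k
  have obj: "selection_objective K B L N0 lam h \<gamma> t = (\<lambda>\<beta>. \<Sum>k\<in>{1..K}. g k (\<beta> k))"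
    by (rule ext)
      (simp add: selection_objective_def g_def sum_subtractf sum_distrib_left)
  have feas: "selection_feasible K = (\<lambda>\<beta>. \<forall>k\<in>{1..K}. \<beta> k \<in> {0..1})"
    by (rule ext) (simp add: selection_feasible_def)
  have less: "g k (p k) < g k x" if k: "k \<in> {1..K}" and x: "x \<in> {0..1}" "x \<noteq> p k" for k x
  proof -
    define d where "d = \<gamma> k * B * T k"
    \<comment> \<open>The factor \<open>ln 2\<close> turns the power of 2 into
      \<open>exp (a * y)\<close>. In \<open>c * a\<close> the factor \<open>d\<close>
      cancels.\<close>
    define a where "a = L * ln 2 / d"
    define c where "c = d * N0 / (h k)\<^sup>2"
    define x0 where "x0 = \<gamma> k * B * T k / L * log 2 (lam * (h k)\<^sup>2 / (N0 * L * ln 2))"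
    have pos: "d > 0" "h k > 0"
      using assms k by (auto simp: d_def)
    then have ac: "a > 0" "c > 0"
      using assms by (auto simp: a_def c_def)
    have "lam / (c * a) = lam * (h k)\<^sup>2 / (N0 * L * ln 2)"
      using pos by (simp add: a_def c_def field_simps)
    then have x0: "x0 = ln (lam / (c * a)) / a"
      using pos \<open>L > 0\<close> by (simp add: x0_def a_def log_def flip: d_def)
    \<comment> \<open>The trailing \<open>c\<close> comes from the \<open>- 1\<close> and cancels in
      comparisons.\<close>
    have g: "g k y = c * exp (a * y) - lam * y - c" for y
      unfolding g_def assms(9)[OF k] d_def[symmetric] c_def a_def powr_def
      by (simp add: algebra_simps)
    have pk: "p k = min (max x0 0) 1"
      by (simp add: p_def x0_def)
    show ?thesis
      using exp_sub_linear_strict_min_interval[OF ac \<open>lam > 0\<close> x(1) _ x0] x(2)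
      by (simp add: g pk)
  qed
  show ?thesis
    unfolding obj feas p_def[symmetric]
    by (rule is_arg_min_sum_iff) (use less in \<open>auto simp: p_def\<close>)
qed

end
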